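(* Let $\mathcal{P}, \mathcal{Q} \subset \mathbb{R}^d$ be lattice polytopes of dimension $d$ all of whose vertices belong to $$\{\mathbf{0}\} \cup \{\mathbf{e}_i \mid 1 \leq i \leq d \} \cup\{\mathbf{e}_i+\mathbf{e}_j \mid 1 \leq i \leq j \leq d \} \subset \mathbb{R}^d,$$ where $\mathbf{e}_1,\ldots,\mathbf{e}_d$ are the canonical unit vectors. If the origin of $\mathbb{R}^{d+1}$ belongs to the interior of $\Omega(\mathcal{P}, \mathcal{Q})$, then $\Omega(\mathcal{P}, \mathcal{Q})$ is reflexive. In particular, $\Omega(\mathcal{P})$ and $\Omega(\mathcal{Q})$ are reflexive.
   Context: For lattice polytopes $\mathcal{P},\mathcal{Q}\subset\mathbb{R}^n$, define $\Omega(\mathcal{P},\mathcal{Q})=\mathrm{conv}\{(\mathcal{P}\times\{1\}) \cup (-\mathcal{Q}\times\{-1\})\}\subset \mathbb{R}^{n+1}$, where $-\mathcal{Q}=\{-\mathbf{a} \mid \mathbf{a}\in\mathcal{Q}\}$, and $\Omega(\mathcal{P})=\Omega(\mathcal{P},\mathcal{P})$. A lattice polytope $\mathcal{R}\subset\mathbb{R}^m$ of dimension $m$ is reflexive if the origin is the unique lattice point in its interior and its dual polytope $\mathcal{R}^\vee=\{\mathbf{y}\in\mathbb{R}^m \mid \langle \mathbf{x},\mathbf{y}\rangle\le 1 \text{ for all } \mathbf{x}\in\mathcal{R}\}$ is also a lattice polytope. *)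

theory Defs
  imports "HOL-Analysis.Analysis"
begin

text \<open>
  The definitions are made for an arbitrary Euclidean space because both \<open>real ^ 'n\<close> (for
  $\mathbf{R}^d$) and \<open>(real ^ 'n) \<times> real\<close> (for $\mathbf{R}^{d+1}$) are used. In both types
  \<open>Basis\<close> consists of the canonical unit vectors, so the lattice points are $\mathbf{Z}^d$ and
  $\mathbf{Z}^{d+1}$.
\<close>

definition lattice_point :: "'a::euclidean_space \<Rightarrow> bool" where
  "lattice_point x \<longleftrightarrow> (\<forall>b\<in>Basis. x \<bullet> b \<in> \<int>)"

definition lattice_polytope :: "'a::euclidean_space set \<Rightarrow> bool" where
  "lattice_polytope P \<longleftrightarrow> polytope P \<and> (\<forall>v. v extreme_point_of P \<longrightarrow> lattice_point v)"

definition dual_polytope :: "'a::euclidean_space set \<Rightarrow> 'a set" where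
  "dual_polytope R = {y. \<forall>x\<in>R. x \<bullet> y \<le> 1}"

definition reflexive_polytope :: "'a::euclidean_space set \<Rightarrow> bool" where
  "reflexive_polytope R \<longleftrightarrow>
     lattice_polytope R \<and> aff_dim R = int DIM('a) \<and>
     {x \<in> interior R. lattice_point x} = {0} \<and>
     lattice_polytope (dual_polytope R)"

definition Omega :: "(real ^ 'n) set \<Rightarrow> (real ^ 'n) set \<Rightarrow> ((real ^ 'n) \<times> real) set" where
  "Omega P Q = convex hull (P \<times> {1} \<union> (uminus ` Q) \<times> {-1})"

text \<open>
  No order on the index type is needed: since $e_i + e_j$ is symmetric in $i$ and $j$, letting
  both range freely yields the same set as the restriction $i \le j$. The case $i = j$, that is
  $2 e_i$, is included.
\<close>

definition allowed_vertices :: "(real ^ 'n) set" where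
  "allowed_vertices =
     {0} \<union> {axis i 1 | i. True} \<union> {axis i 1 + axis j 1 | i j. True}"

end

theory Submission
  imports Defs
begin

text \<open>
  Put $x_0 = b/2$ and $x_i = a_i + b/2$. On the points $(v,1)$ with $v$ equal to $0$, $e_i$,
  $e_i+e_j$ the functional $(a,b)$ takes the values $2x_0$, $x_0+x_i$, $x_i+x_j$. If $(a,b)$ is an
  extreme point of the dual of $\Omega(P,Q)$, then it is determined by its tight constraints, all of
  the form $x_i+x_j=\pm 1$. Since $\cos(\pi s)+\cos(\pi t)=0$ whenever $s+t$ is an odd integer,
  moving $x$ in the direction $(\cos \pi x_i)_i$ keeps the tight constraints tight. Hence this
  direction vanishes, i.e. every $x_i$ is half an odd integer, and so $b = 2x_0$ and
  $a_i = x_i-x_0$ are integers. Integrality of the dual forces the origin to be the only interior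
  lattice point.
\<close>

section \<open>Dual polytopes and their extreme points\<close>

lemma dual_polytope_convex_hull:
  "dual_polytope (convex hull V) = {y. \<forall>x\<in>V. x \<bullet> y \<le> 1}"
proof -
  have "x \<bullet> y \<le> 1" if "\<forall>x\<in>V. x \<bullet> y \<le> 1" "x \<in> convex hull V" for x y
  proof -
    have "V \<subseteq> {x. y \<bullet> x \<le> 1}" using that(1) by (auto simp: inner_commute)
    then have "convex hull V \<subseteq> {x. y \<bullet> x \<le> 1}"
      by (rule hull_minimal) (rule convex_halfspace_le)
    then show ?thesis using that(2) by (auto simp: inner_commute)
  qed
  then show ?thesis
    unfolding dual_polytope_def by (auto intro: hull_inc)
qed

text \<open>If \<open>R\<close> contains the ball of radius e about the origin, the point of norm e
  in the direction of a nonzero dual point y lies in \<open>R\<close> and pairs with y to e times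
  the norm of y. Hence the dual lies in the ball of radius 1/e.\<close>

lemma bounded_dual_polytope:
  assumes "0 \<in> interior R"
  shows "bounded (dual_polytope R)"
proof -
  obtain e where e: "e > 0" "cball 0 e \<subseteq> R"
    using assms mem_interior_cball by blast
  have "norm y \<le> 1 / e" if y: "y \<in> dual_polytope R" for y
  proof (cases "y = 0")
    case False
    have "(e / norm y) *\<^sub>R y \<in> R"
      using e False by (intro subsetD[OF e(2)]) auto
    then have "((e / norm y) *\<^sub>R y) \<bullet> y \<le> 1"
      using y by (auto simp: dual_polytope_def)
    then have "e * norm y \<le> 1"
      using False by (simp add: power2_norm_eq_inner[symmetric] power2_eq_square)
    then show ?thesis using e by (simp add: field_simps)
  qed (use e in auto)
  then show ?thesis by (auto simp: bounded_iff)
qed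

lemma polytope_dual_polytope:
  assumes "finite V" "0 \<in> interior (convex hull V)"
  shows "polytope (dual_polytope (convex hull V))"
proof -
  have "{y. \<forall>x\<in>V. x \<bullet> y \<le> 1} = \<Inter> ((\<lambda>x. {y. x \<bullet> y \<le> 1}) ` V)" by auto
  moreover have "polyhedron \<dots>"
    using assms(1) by (intro polyhedron_Inter) (auto simp: polyhedron_halfspace_le)
  ultimately have "polyhedron (dual_polytope (convex hull V))"
    by (simp add: dual_polytope_convex_hull)
  then show ?thesis
    using bounded_dual_polytope[OF assms(2)] by (simp add: polytope_eq_bounded_polyhedron)
qed

text \<open>Moving along \<open>s\<close> leaves tight constraints unchanged, and a small enough
  move violates no slack one. A nonzero \<open>s\<close> would thus make \<open>y\<close> the
  midpoint of a proper segment in the dual.\<close>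

lemma extreme_point_dual_direction_zero:
  assumes V: "finite V"
    and y: "y extreme_point_of dual_polytope (convex hull V)"
    and tight: "\<And>x. x \<in> V \<Longrightarrow> x \<bullet> y = 1 \<Longrightarrow> x \<bullet> s = 0"
  shows "s = 0"
proof (rule ccontr)
  assume "s \<noteq> 0"
  have yV: "x \<bullet> y \<le> 1" if "x \<in> V" for x
    using y that by (auto simp: extreme_point_of_def dual_polytope_convex_hull)
  \<comment> \<open>Each constraint holds for all small positive e; finiteness of \<open>V\<close>
    yields one e for all of them, without an explicit minimum of the slacks.\<close>
  have "\<forall>\<^sub>F e in at_right 0. \<forall>x\<in>V. x \<bullet> (y + e *\<^sub>R s) \<le> 1 \<and> x \<bullet> (y - e *\<^sub>R s) \<le> 1"
  proof (rule eventually_ball_finite[OF V], rule ballI)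
    fix x assume x: "x \<in> V"
    show "\<forall>\<^sub>F e in at_right 0. x \<bullet> (y + e *\<^sub>R s) \<le> 1 \<and> x \<bullet> (y - e *\<^sub>R s) \<le> 1"
    proof (cases "x \<bullet> y = 1")
      case True
      then show ?thesis using tight[OF x True] by (simp add: inner_add_right inner_diff_right)
    next
      case False
      then have lt: "x \<bullet> y < 1" using yV[OF x] by simp
      have "((\<lambda>e. x \<bullet> (y + e *\<^sub>R s)) \<longlongrightarrow> x \<bullet> (y + 0 *\<^sub>R s)) (at_right 0)"
        by (intro tendsto_intros)
      then have 1: "\<forall>\<^sub>F e in at_right 0. x \<bullet> (y + e *\<^sub>R s) < 1"
        using lt by (intro order_tendstoD(2)) auto
      have "((\<lambda>e. x \<bullet> (y - e *\<^sub>R s)) \<longlongrightarrow> x \<bullet> (y - 0 *\<^sub>R s)) (at_right 0)"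
        by (intro tendsto_intros)
      then have 2: "\<forall>\<^sub>F e in at_right 0. x \<bullet> (y - e *\<^sub>R s) < 1"
        using lt by (intro order_tendstoD(2)) auto
      show ?thesis using 1 2 by eventually_elim auto
    qed
  qed
  moreover have "\<forall>\<^sub>F e in at_right (0::real). e > 0"
    by (rule eventually_at_right_less)
  ultimately have "\<forall>\<^sub>F e in at_right 0. e > 0 \<and>
      (\<forall>x\<in>V. x \<bullet> (y + e *\<^sub>R s) \<le> 1 \<and> x \<bullet> (y - e *\<^sub>R s) \<le> 1)"
    by eventually_elim auto
  then obtain e where e: "e > 0"
      "\<forall>x\<in>V. x \<bullet> (y + e *\<^sub>R s) \<le> 1 \<and> x \<bullet> (y - e *\<^sub>R s) \<le> 1"
    using eventually_happens'[OF trivial_limit_at_right_real] by blast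
  have "y + e *\<^sub>R s \<in> dual_polytope (convex hull V)" "y - e *\<^sub>R s \<in> dual_polytope (convex hull V)"
    using e(2) by (auto simp: dual_polytope_convex_hull)
  moreover have "midpoint (y + e *\<^sub>R s) (y - e *\<^sub>R s) = y"
    by (simp add: midpoint_def scaleR_2[symmetric])
  moreover have "y + e *\<^sub>R s \<noteq> y - e *\<^sub>R s"
  proof
    assume "y + e *\<^sub>R s = y - e *\<^sub>R s"
    then have "(2 * e) *\<^sub>R s = 0" by (simp add: scaleR_2[symmetric] eq_diff_eq add.assoc)
    then show False using \<open>e > 0\<close> \<open>s \<noteq> 0\<close> by simp
  qed
  ultimately show False
    using y unfolding extreme_point_of_def by (metis midpoint_in_open_segment)
qed

section \<open>A criterion for reflexivity\<close>

lemma lattice_point_inner: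
  assumes "lattice_point x" "lattice_point y"
  shows "x \<bullet> y \<in> \<int>"
  using assms unfolding lattice_point_def euclidean_inner[of x y]
  by (intro Ints_sum Ints_mult) auto

text \<open>An interior lattice point pairs with each extreme point of the dual to an integer below
  1, hence to at most 0, and so with the whole dual. By separation the ray through it then stays in
  \<open>R\<close>, which for a nonzero point contradicts boundedness.\<close>

lemma interior_lattice_point_eq_zero:
  fixes R :: "'a::euclidean_space set"
  assumes R: "convex R" "compact R" "0 \<in> interior R"
    and dual: "lattice_polytope (dual_polytope R)"
    and x: "x \<in> interior R" "lattice_point x"
  shows "x = 0"
proof (rule ccontr)
  assume "x \<noteq> 0"
  let ?D = "dual_polytope R"
  have "polytope ?D" using dual by (simp add: lattice_polytope_def)
  have D: "?D = convex hull {y. y extreme_point_of ?D}"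
    using \<open>polytope ?D\<close> by (intro Krein_Milman_Minkowski polytope_imp_compact polytope_imp_convex)
  obtain e where e: "e > 0" "cball x e \<subseteq> R" using x(1) mem_interior_cball by blast
  have ext: "x \<bullet> y \<le> 0" if y: "y extreme_point_of ?D" for y
  proof -
    have "y \<in> ?D" using y by (simp add: extreme_point_of_def)
    \<comment> \<open>Stretching \<open>x\<close> by 1 + c keeps it inside \<open>R\<close>; this
      makes the inequality with 1 strict.\<close>
    obtain c where c: "c > 0" "c * norm x \<le> e"
      using e \<open>x \<noteq> 0\<close> by (intro that[of "e / norm x"]) auto
    have "x + c *\<^sub>R x \<in> R"
      using c by (intro subsetD[OF e(2)]) (auto simp: dist_norm)
    then have "(x + c *\<^sub>R x) \<bullet> y \<le> 1" using \<open>y \<in> ?D\<close> unfolding dual_polytope_def by blast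
    then have le: "(1 + c) * (x \<bullet> y) \<le> 1" by (simp add: inner_add_left algebra_simps)
    have "x \<bullet> y < 1"
    proof (rule ccontr)
      assume "\<not> x \<bullet> y < 1"
      then have "(1 + c) * 1 \<le> (1 + c) * (x \<bullet> y)" using c by (intro mult_left_mono) auto
      from order_trans[OF this le] show False using c by simp
    qed
    moreover have "x \<bullet> y \<in> \<int>"
      using dual y x(2) by (intro lattice_point_inner) (auto simp: lattice_polytope_def)
    ultimately show ?thesis by (auto elim!: Ints_cases)
  qed
  have all: "x \<bullet> y \<le> 0" if "y \<in> ?D" for y
  proof -
    have "convex hull {y. y extreme_point_of ?D} \<subseteq> {y. x \<bullet> y \<le> 0}"
      using ext by (intro hull_minimal convex_halfspace_le) auto
    then show ?thesis using that D by blast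
  qed
  have ray: "k *\<^sub>R x \<in> R" if "k \<ge> 0" for k
  proof (rule ccontr)
    assume "k *\<^sub>R x \<notin> R"
    then obtain a b where ab: "a \<bullet> (k *\<^sub>R x) < b" "\<forall>z\<in>R. a \<bullet> z > b"
      using separating_hyperplane_closed_point[OF R(1) compact_imp_closed[OF R(2)]] by blast
    have "0 \<in> R" using R(3) interior_subset by blast
    then have "b < 0" using ab(2) by force
    \<comment> \<open>Since b is negative, dividing \<open>a \<bullet> z > b\<close> by b reverses
      it and yields the bound 1 that defines the dual.\<close>
    have "(1 / b) *\<^sub>R a \<in> ?D"
      unfolding dual_polytope_def
    proof (intro CollectI ballI)
      fix z assume "z \<in> R"
      then show "z \<bullet> (1 / b) *\<^sub>R a \<le> 1"
        using ab(2) \<open>b < 0\<close> by (auto simp: inner_commute divide_le_eq less_imp_le)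
    qed
    from all[OF this] have "a \<bullet> x \<ge> 0"
      using \<open>b < 0\<close> by (simp add: inner_commute divide_le_0_iff)
    then have "a \<bullet> (k *\<^sub>R x) \<ge> 0" using that by simp
    then show False using ab(1) \<open>b < 0\<close> by linarith
  qed
  obtain B where B: "\<forall>z\<in>R. norm z \<le> B" using compact_imp_bounded[OF R(2)] bounded_iff by blast
  \<comment> \<open>The factor is chosen so that this point of the ray has norm
    \<open>\<bar>B\<bar> + 1\<close>, above the bound \<open>B\<close>.\<close>
  have "norm (((\<bar>B\<bar> + 1) / norm x) *\<^sub>R x) \<le> B" by (intro B[rule_format] ray) simp
  then show False using \<open>x \<noteq> 0\<close> by simp
qed

text \<open>Once the origin is interior, integrality of the dual is the only clause that depends on
  the particular shape of a lattice polytope.\<close>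

lemma reflexive_polytopeI:
  fixes V :: "'a::euclidean_space set"
  assumes V: "finite V" "\<And>v. v \<in> V \<Longrightarrow> lattice_point v"
    and zero: "0 \<in> interior (convex hull V)"
    and dual: "\<And>y. y extreme_point_of dual_polytope (convex hull V) \<Longrightarrow> lattice_point y"
  shows "reflexive_polytope (convex hull V)"
proof -
  have "lattice_polytope (convex hull V)"
    using V extreme_point_of_convex_hull by (fastforce simp: lattice_polytope_def polytope_def)
  moreover have "aff_dim (convex hull V) = int DIM('a)"
    using zero by (intro aff_dim_nonempty_interior) auto
  moreover have lat: "lattice_polytope (dual_polytope (convex hull V))"
    using polytope_dual_polytope[OF V(1) zero] dual by (simp add: lattice_polytope_def)
  moreover have "{x \<in> interior (convex hull V). lattice_point x} = {0}"
    using interior_lattice_point_eq_zero[OF convex_convex_hull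
        finite_imp_compact_convex_hull[OF V(1)] zero lat] zero
    by (auto simp: lattice_point_def)
  ultimately show ?thesis by (simp add: reflexive_polytope_def)
qed

section \<open>The cosine direction\<close>

lemma cos_pi_add_cos_pi_eq_0:
  fixes s t :: real
  assumes "\<bar>s + t\<bar> = 1"
  shows "cos (pi * s) + cos (pi * t) = 0"
proof -
  have "t = 1 - s \<or> t = - 1 - s" using assms by linarith
  then show ?thesis
  proof
    assume "t = 1 - s"
    then have "pi * t = pi - pi * s" by (simp only: right_diff_distrib mult_1_right)
    then show ?thesis by (simp add: cos_diff)
  next
    assume "t = - 1 - s"
    then have "pi * t = - (pi + pi * s)" by (simp add: right_diff_distrib)
    then show ?thesis by (simp only: cos_minus) (simp add: cos_add)
  qed
qed

lemma cos_pi_eq_0_odd: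
  fixes x :: real
  assumes "cos (pi * x) = 0"
  obtains k :: int where "x = real_of_int k + 1 / 2"
proof -
  obtain i where i: "odd i" "pi * x = of_int i * (pi / 2)"
    using assms by (auto simp: cos_zero_iff_int)
  from i(1) obtain k where "i = 2 * k + 1" by (rule oddE)
  with i(2) have "pi * x = pi * (real_of_int k + 1 / 2)" by (simp add: algebra_simps)
  then have "x = real_of_int k + 1 / 2" by (simp only: mult_cancel_left) simp
  then show ?thesis by (rule that)
qed

lemma lattice_point_allowed_vertices:
  assumes "v \<in> allowed_vertices"
  shows "lattice_point v"
  using assms by (auto simp: allowed_vertices_def lattice_point_def Basis_vec_def inner_add_left inner_axis_axis)

lemma lattice_point_Pair_iff:
  "lattice_point (v, t :: real) \<longleftrightarrow> lattice_point v \<and> t \<in> \<int>"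
  by (simp add: lattice_point_def Basis_prod_def ball_Un conj_commute)

lemma lattice_point_uminus: "lattice_point v \<Longrightarrow> lattice_point (- v)"
  by (simp add: lattice_point_def)

text \<open>With x_0 = b/2 and x_i = a_i + b/2 this is the direction with entries cos (pi x_0) and
  cos (pi x_i), carried back to (a, b) by the linear map a_i = x_i - x_0, b = 2 x_0.\<close>

definition cos_direction :: "(real ^ 'n) \<times> real \<Rightarrow> (real ^ 'n) \<times> real" where
  "cos_direction y =
     (\<chi> i. cos (pi * (fst y $ i + snd y / 2)) - cos (pi * (snd y / 2)), 2 * cos (pi * (snd y / 2)))"

text \<open>Pairing with \<open>(v, 1)\<close> adds two of the coordinates x_0, x_i, so on the
  cosine direction it gives the sum of the two corresponding cosines. The absolute value covers the
  constraints from \<open>(v, 1)\<close> and from its negative at once.\<close>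

lemma cos_direction_tight:
  fixes y :: "(real ^ 'n) \<times> real"
  assumes v: "v \<in> allowed_vertices" and tight: "\<bar>(v, 1) \<bullet> y\<bar> = 1"
  shows "(v, 1) \<bullet> cos_direction y = 0"
proof -
  obtain a b where y: "y = (a, b)" by (cases y)
  let ?h = "b / 2"
  consider "v = 0" | i where "v = axis i 1" | i j where "v = axis i 1 + axis j 1"
    using v by (auto simp: allowed_vertices_def)
  then show ?thesis
  proof cases
    case 1
    then have "\<bar>?h + ?h\<bar> = 1" using tight by (simp add: y)
    from cos_pi_add_cos_pi_eq_0[OF this] show ?thesis by (simp add: 1 y cos_direction_def)
  next
    case 2
    then have "\<bar>(a $ i + ?h) + ?h\<bar> = 1" using tight by (simp add: y inner_axis')
    from cos_pi_add_cos_pi_eq_0[OF this] show ?thesis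
      by (simp add: 2 y cos_direction_def inner_axis')
  next
    case 3
    then have "\<bar>(a $ i + ?h) + (a $ j + ?h)\<bar> = 1"
      using tight by (simp add: y inner_axis' inner_add_left algebra_simps)
    from cos_pi_add_cos_pi_eq_0[OF this] show ?thesis
      by (simp add: 3 y cos_direction_def inner_axis' inner_add_left)
  qed
qed

lemma lattice_point_if_cos_direction_eq_0:
  fixes y :: "(real ^ 'n) \<times> real"
  assumes "cos_direction y = 0"
  shows "lattice_point y"
proof -
  obtain a b where y: "y = (a, b)" by (cases y)
  \<comment> \<open>The last component comes first: only after cos (pi x_0) vanishes do the other
    components reduce to cos (pi x_i).\<close>
  have h: "cos (pi * (b / 2)) = 0" using assms by (simp add: y cos_direction_def zero_prod_def)
  then obtain k where k: "b / 2 = real_of_int k + 1 / 2" by (rule cos_pi_eq_0_odd)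
  have a: "a $ i \<in> \<int>" for i
  proof -
    have "cos (pi * (a $ i + b / 2)) = 0"
      using assms h by (simp add: y cos_direction_def zero_prod_def vec_eq_iff)
    then obtain l where "a $ i + b / 2 = real_of_int l + 1 / 2" by (rule cos_pi_eq_0_odd)
    then have "a $ i = real_of_int (l - k)" using k by simp
    then show ?thesis by (metis Ints_of_int)
  qed
  have "b = real_of_int (2 * k + 1)" using k by simp
  then have "b \<in> \<int>" by (metis Ints_of_int)
  then show ?thesis
    using a unfolding y lattice_point_Pair_iff
    by (auto simp: lattice_point_def Basis_vec_def inner_axis)
qed

section \<open>Reflexivity of \<open>Omega P Q\<close>\<close>

lemma Omega_eq_convex_hull_vertices:
  assumes "polytope P" "polytope Q"
  shows "Omega P Q = convex hull ({v. v extreme_point_of P} \<times> {1} \<union>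
           uminus ` {v. v extreme_point_of Q} \<times> {-1})"
proof -
  let ?A = "{v. v extreme_point_of P}" and ?B = "{v. v extreme_point_of Q}"
  have P: "P = convex hull ?A" and Q: "Q = convex hull ?B"
    using assms by (auto intro!: Krein_Milman_Minkowski polytope_imp_compact polytope_imp_convex)
  have "P \<times> {1} = convex hull (?A \<times> {1::real})"
    by (subst P) (simp add: convex_hull_Times)
  moreover have "uminus ` Q \<times> {-1} = convex hull (uminus ` ?B \<times> {-1::real})"
    by (subst Q) (simp add: convex_hull_Times convex_hull_linear_image linear_uminus)
  \<comment> \<open>The hull of a union is unchanged when either set is replaced by its
    hull.\<close>
  ultimately show ?thesis
    unfolding Omega_def by (metis hull_Un_left hull_Un_right)
qed

lemma reflexive_Omega:
  fixes P Q :: "(real ^ 'n) set"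
  assumes "polytope P" "polytope Q"
    and P: "\<And>v. v extreme_point_of P \<Longrightarrow> v \<in> allowed_vertices"
    and Q: "\<And>v. v extreme_point_of Q \<Longrightarrow> v \<in> allowed_vertices"
    and zero: "0 \<in> interior (Omega P Q)"
  shows "reflexive_polytope (Omega P Q)"
proof -
  define V :: "((real ^ 'n) \<times> real) set" where
    "V = {v. v extreme_point_of P} \<times> {1} \<union> uminus ` {v. v extreme_point_of Q} \<times> {-1}"
  have Omega: "Omega P Q = convex hull V"
    unfolding V_def using assms(1,2) by (rule Omega_eq_convex_hull_vertices)
  \<comment> \<open>A vertex v of \<open>Q\<close> contributes (-v, -1) = -(v, 1), so both families
    differ only by a sign.\<close>
  have V: "(\<exists>v\<in>allowed_vertices. x = (v, 1) \<or> x = - (v, 1))" if "x \<in> V" for x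
    using that P Q by (auto simp: V_def)
  have fin: "finite V"
    using assms(1,2) by (auto simp: V_def finite_polyhedron_extreme_points polytope_imp_polyhedron)
  show ?thesis
    unfolding Omega
  proof (rule reflexive_polytopeI[OF fin])
    have "lattice_point (v, 1::real)" if "v \<in> allowed_vertices" for v :: "real ^ 'n"
      using lattice_point_allowed_vertices[OF that]
      by (simp add: lattice_point_Pair_iff)
    then show "lattice_point x" if "x \<in> V" for x
      using V[OF that] lattice_point_uminus by blast
    show "0 \<in> interior (convex hull V)" using zero by (simp add: Omega)
    fix y assume y: "y extreme_point_of dual_polytope (convex hull V)"
    have "cos_direction y = 0"
    proof (rule extreme_point_dual_direction_zero[OF fin y])
      fix x assume x: "x \<in> V" "x \<bullet> y = 1"
      from V[OF x(1)] obtain v where v: "v \<in> allowed_vertices" "x = (v, 1) \<or> x = - (v, 1)" by blast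
      then have "\<bar>(v, 1) \<bullet> y\<bar> = 1" using x(2) by (metis abs_minus_cancel abs_one inner_minus_left)
      from cos_direction_tight[OF v(1) this] show "x \<bullet> cos_direction y = 0"
        using v(2) by (metis inner_minus_left neg_0_equal_iff_equal)
    qed
    then show "lattice_point y" by (rule lattice_point_if_cos_direction_eq_0)
  qed
qed

section \<open>Central symmetry of \<open>Omega P P\<close>\<close>

lemma uminus_Omega_self:
  fixes P :: "(real ^ 'n) set"
  shows "uminus ` Omega P P = Omega P P"
proof -
  have eq: "uminus = (\<lambda>(x :: real ^ 'n, t :: real). (- x, - t))" by (auto simp: fun_eq_iff)
  have neg: "uminus ` (A \<times> {t}) = uminus ` A \<times> {- t}" for A :: "(real ^ 'n) set" and t :: real
    unfolding eq image_paired_Times by simp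
  \<comment> \<open>Negation exchanges the slices at heights 1 and -1.\<close>
  have "uminus ` (P \<times> {1::real} \<union> uminus ` P \<times> {-1}) = P \<times> {1} \<union> uminus ` P \<times> {-1}"
    by (simp add: image_Un neg image_image Un_commute)
  then show ?thesis
    unfolding Omega_def by (metis convex_hull_linear_image linear_uminus)
qed

text \<open>A centrally symmetric convex set with an interior point x also has -x in its interior,
  and hence their midpoint 0. The interior is nonempty because a hyperplane containing
  \<open>Omega P P\<close> would force \<open>P\<close> into a hyperplane.\<close>

lemma zero_in_interior_Omega_self:
  fixes P :: "(real ^ 'n) set"
  assumes "aff_dim P = int CARD('n)"
  shows "0 \<in> interior (Omega P P)"
proof -
  have conv: "convex (Omega P P)" by (simp add: Omega_def)
  have "interior (Omega P P) \<noteq> {}"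
  proof
    assume "interior (Omega P P) = {}"
    then obtain a b where "a \<noteq> 0" and sub: "Omega P P \<subseteq> {x. a \<bullet> x = b}"
      using empty_interior_subset_hyperplane[OF conv] by blast
    obtain u t where a: "a = (u, t)" by (cases a)
    have eq: "u \<bullet> p + t = b" "- (u \<bullet> p) - t = b" if "p \<in> P" for p
    proof -
      have "(p, 1) \<in> Omega P P" "(- p, - 1) \<in> Omega P P"
        using that by (auto simp: Omega_def intro!: hull_inc)
      then have "a \<bullet> (p, 1) = b" "a \<bullet> (- p, - 1) = b" using sub by blast+
      then show "u \<bullet> p + t = b" "- (u \<bullet> p) - t = b" by (auto simp: a)
    qed
    have "u = 0"
    proof (rule ccontr)
      assume "u \<noteq> 0"
      have "P \<subseteq> {x. u \<bullet> x = b - t}" using eq(1) by fastforce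
      then have "aff_dim P \<le> aff_dim {x. u \<bullet> x = b - t}" by (rule aff_dim_subset)
      then show False using assms \<open>u \<noteq> 0\<close> by (simp add: aff_dim_hyperplane)
    qed
    \<comment> \<open>The empty set has affine dimension -1, so \<open>P\<close> is nonempty. With u
      = 0 the two equations read t = b and -t = b.\<close>
    moreover obtain p where "p \<in> P" using assms by fastforce
    ultimately have "t = 0" using eq[of p] by simp
    then show False using \<open>a \<noteq> 0\<close> \<open>u = 0\<close> by (simp add: a zero_prod_def)
  qed
  then obtain x where x: "x \<in> interior (Omega P P)" by blast
  then have "- x \<in> interior (Omega P P)"
    by (metis imageI interior_negations uminus_Omega_self)
  then have "midpoint x (- x) \<in> interior (Omega P P)"
    using x conv by (metis convexD_alt convex_contains_segment convex_interior midpoint_in_closed_segment subsetD)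
  then show ?thesis by (simp add: midpoint_def)
qed

theorem theorem2p1:
  fixes P Q :: "(real ^ 'n) set"
  assumes "lattice_polytope P" and "aff_dim P = int CARD('n)"
    and "lattice_polytope Q" and "aff_dim Q = int CARD('n)"
    and "\<And>v. v extreme_point_of P \<Longrightarrow> v \<in> allowed_vertices"
    and "\<And>v. v extreme_point_of Q \<Longrightarrow> v \<in> allowed_vertices"
  shows "(0 \<in> interior (Omega P Q) \<longrightarrow> reflexive_polytope (Omega P Q))
    \<and> reflexive_polytope (Omega P P) \<and> reflexive_polytope (Omega Q Q)"
  using assms unfolding lattice_polytope_def
  by (blast intro: reflexive_Omega zero_in_interior_Omega_self)

end
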